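(* Let $X$ be a real Banach space which is self-dual, and let $T:X\to X^\ast$ be an isomorphism onto $X^\ast$. Suppose that for every closed subspace $M$ of $X$ the map $$\pi_M\circ T|_M: M\to X^\ast/M^\bot$$ is an isomorphism onto $X^\ast/M^\bot$, where $\pi_M:X^\ast\to X^\ast/M^\bot$ is the natural quotient map. Then $X$ is isomorphic to a Hilbert space.
   Context: $X^\ast$ is the (topological) dual of $X$ and $\langle x^\ast,x\rangle=x^\ast(x)$. A Banach space is self-dual if it is isomorphic to its dual. "Isomorphism" means a bounded linear bijection with bounded inverse; "isomorphic" means linearly homeomorphic. For a subspace $M$ of $X$, the annihilator is $M^\bot=\{x^\ast\in X^\ast: \langle x^\ast,x\rangle=0\text{ for all }x\in M\}$. Hilbert spaces are real. *)

theory Defs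
  imports "HOL-Analysis.Analysis"
begin

text \<open>
  The library treats normed and inner product spaces as types, whereas a quotient by a subspace
  \<open>M\<close> (with \<open>M\<close> universally quantified) and an existentially quantified Hilbert space require
  spaces as values, hence the following records with explicit carriers.
\<close>

record 'v vspace =
  carrier :: "'v set"
  vzero :: 'v
  vadd :: "'v \<Rightarrow> 'v \<Rightarrow> 'v"
  vscale :: "real \<Rightarrow> 'v \<Rightarrow> 'v"

record 'v nspace = "'v vspace" +
  vnorm :: "'v \<Rightarrow> real"

record 'v ispace = "'v vspace" +
  vinner :: "'v \<Rightarrow> 'v \<Rightarrow> real"


definition bounded_linear_map ::
  "('v, 'r) nspace_scheme \<Rightarrow> ('w, 's) nspace_scheme \<Rightarrow> ('v \<Rightarrow> 'w) \<Rightarrow> bool" where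
  "bounded_linear_map V W f \<longleftrightarrow>
     (\<forall>x\<in>carrier V. f x \<in> carrier W) \<and>
     (\<forall>x\<in>carrier V. \<forall>y\<in>carrier V. f (vadd V x y) = vadd W (f x) (f y)) \<and>
     (\<forall>r. \<forall>x\<in>carrier V. f (vscale V r x) = vscale W r (f x)) \<and>
     (\<exists>K. \<forall>x\<in>carrier V. vnorm W (f x) \<le> K * vnorm V x)"

definition isomorphism ::
  "('v, 'r) nspace_scheme \<Rightarrow> ('w, 's) nspace_scheme \<Rightarrow> ('v \<Rightarrow> 'w) \<Rightarrow> bool" where
  "isomorphism V W f \<longleftrightarrow>
     bounded_linear_map V W f \<and> bij_betw f (carrier V) (carrier W) \<and>
     bounded_linear_map W V (inv_into (carrier V) f)"


definition subspace_nspace :: "'a::real_normed_vector set \<Rightarrow> 'a nspace" where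
  "subspace_nspace M =
     \<lparr>carrier = M, vzero = 0, vadd = (+), vscale = scaleR, vnorm = norm\<rparr>"

lemma carrier_subspace_nspace [simp]: "carrier (subspace_nspace M) = M"
  by (simp add: subspace_nspace_def)

lemma bounded_linear_map_UNIV_iff:
  "bounded_linear_map (subspace_nspace UNIV) (subspace_nspace UNIV) f \<longleftrightarrow> bounded_linear f"
  by (auto simp: bounded_linear_map_def subspace_nspace_def bounded_linear_def
      bounded_linear_axioms_def linear_iff mult.commute)

lemma isomorphism_UNIV_iff:
  "isomorphism (subspace_nspace UNIV) (subspace_nspace UNIV) f \<longleftrightarrow>
     bounded_linear f \<and> bij f \<and> bounded_linear (inv f)"
  by (simp add: isomorphism_def bounded_linear_map_UNIV_iff)


definition quotient_proj :: "'a::real_normed_vector set \<Rightarrow> 'a \<Rightarrow> 'a set" where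
  "quotient_proj N x = (\<lambda>n. x + n) ` N"

text \<open>
  In \<open>vscale\<close> the summand \<open>n\<close> matters only for \<open>r = 0\<close>, where the pointwise multiple of a coset
  would be \<open>{0}\<close> instead of \<open>N\<close>.
\<close>

definition quotient_nspace :: "'a::real_normed_vector set \<Rightarrow> 'a set nspace" where
  "quotient_nspace N =
     \<lparr>carrier = range (quotient_proj N), vzero = N,
      vadd = (\<lambda>A B. {a + b | a b. a \<in> A \<and> b \<in> B}),
      vscale = (\<lambda>r A. {r *\<^sub>R a + n | a n. a \<in> A \<and> n \<in> N}),
      vnorm = (\<lambda>A. Inf (norm ` A))\<rparr>"

lemma quotient_proj_zero: "quotient_proj N 0 = vzero (quotient_nspace N)"
  by (simp add: quotient_proj_def quotient_nspace_def)

lemma quotient_proj_eq_iff: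
  assumes "subspace N"
  shows "quotient_proj N x = quotient_proj N y \<longleftrightarrow> x - y \<in> N"
proof
  assume "quotient_proj N x = quotient_proj N y"
  moreover have "x \<in> quotient_proj N x"
    using subspace_0[OF assms] by (force simp: quotient_proj_def)
  ultimately show "x - y \<in> N" by (auto simp: quotient_proj_def)
next
  have sub: "quotient_proj N u \<subseteq> quotient_proj N v" if "u - v \<in> N" for u v
  proof
    fix z assume "z \<in> quotient_proj N u"
    then obtain n where "n \<in> N" "z = v + ((u - v) + n)" by (auto simp: quotient_proj_def)
    then show "z \<in> quotient_proj N v"
      using subspace_add[OF assms that] unfolding quotient_proj_def by blast
  qed
  assume "x - y \<in> N"
  moreover from this have "y - x \<in> N" using subspace_neg[OF assms, of "x - y"] by simp
  ultimately show "quotient_proj N x = quotient_proj N y" using sub by blast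
qed

lemma quotient_proj_add:
  assumes "subspace N"
  shows "quotient_proj N (x + y) = vadd (quotient_nspace N) (quotient_proj N x) (quotient_proj N y)"
proof -
  have "\<exists>a b. x + y + n = a + b \<and> a \<in> (+) x ` N \<and> b \<in> (+) y ` N" if "n \<in> N" for n
    by (rule exI[of _ "x + n"], rule exI[of _ "y + 0"])
       (use that subspace_0[OF assms] in \<open>auto simp: algebra_simps\<close>)
  moreover have "x + n + (y + m) \<in> (+) (x + y) ` N" if "n \<in> N" "m \<in> N" for n m
    using subspace_add[OF assms that] by (auto simp: image_iff algebra_simps)
  ultimately show ?thesis
    by (auto simp: quotient_proj_def quotient_nspace_def)
qed

lemma quotient_proj_scaleR:
  assumes "subspace N"
  shows "quotient_proj N (r *\<^sub>R x) = vscale (quotient_nspace N) r (quotient_proj N x)"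
proof -
  have "\<exists>a m. r *\<^sub>R x + n = r *\<^sub>R a + m \<and> a \<in> (+) x ` N \<and> m \<in> N" if "n \<in> N" for n
    by (rule exI[of _ "x + 0"], rule exI[of _ n])
       (use that subspace_0[OF assms] in auto)
  moreover have "r *\<^sub>R (x + n) + m \<in> (+) (r *\<^sub>R x) ` N" if "n \<in> N" "m \<in> N" for n m
    using subspace_add[OF assms subspace_scale[OF assms that(1), of r] that(2)]
    by (auto simp: image_iff algebra_simps)
  ultimately show ?thesis
    by (auto simp: quotient_proj_def quotient_nspace_def)
qed


definition annihilator :: "'a::real_normed_vector set \<Rightarrow> ('a \<Rightarrow>\<^sub>L real) set" where
  "annihilator M = {x'. \<forall>x\<in>M. blinfun_apply x' x = 0}"

lemma subspace_annihilator: "subspace (annihilator M)"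
  by (auto simp: subspace_def annihilator_def plus_blinfun.rep_eq scaleR_blinfun.rep_eq)


definition real_vspace :: "('v, 'r) vspace_scheme \<Rightarrow> bool" where
  "real_vspace V \<longleftrightarrow>
     vzero V \<in> carrier V \<and>
     (\<forall>x\<in>carrier V. \<forall>y\<in>carrier V. vadd V x y \<in> carrier V) \<and>
     (\<forall>r. \<forall>x\<in>carrier V. vscale V r x \<in> carrier V) \<and>
     (\<forall>x\<in>carrier V. \<forall>y\<in>carrier V. \<forall>z\<in>carrier V.
        vadd V (vadd V x y) z = vadd V x (vadd V y z)) \<and>
     (\<forall>x\<in>carrier V. \<forall>y\<in>carrier V. vadd V x y = vadd V y x) \<and>
     (\<forall>x\<in>carrier V. vadd V (vzero V) x = x) \<and>
     (\<forall>x\<in>carrier V. \<exists>y\<in>carrier V. vadd V x y = vzero V) \<and>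
     (\<forall>r. \<forall>x\<in>carrier V. \<forall>y\<in>carrier V.
        vscale V r (vadd V x y) = vadd V (vscale V r x) (vscale V r y)) \<and>
     (\<forall>r s. \<forall>x\<in>carrier V. vscale V (r + s) x = vadd V (vscale V r x) (vscale V s x)) \<and>
     (\<forall>r s. \<forall>x\<in>carrier V. vscale V r (vscale V s x) = vscale V (r * s) x) \<and>
     (\<forall>x\<in>carrier V. vscale V 1 x = x)"

definition real_ispace :: "('v, 'r) ispace_scheme \<Rightarrow> bool" where
  "real_ispace H \<longleftrightarrow>
     real_vspace H \<and>
     (\<forall>x\<in>carrier H. \<forall>y\<in>carrier H. vinner H x y = vinner H y x) \<and>
     (\<forall>x\<in>carrier H. \<forall>y\<in>carrier H. \<forall>z\<in>carrier H.
        vinner H (vadd H x y) z = vinner H x z + vinner H y z) \<and>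
     (\<forall>r. \<forall>x\<in>carrier H. \<forall>y\<in>carrier H. vinner H (vscale H r x) y = r * vinner H x y) \<and>
     (\<forall>x\<in>carrier H. 0 \<le> vinner H x x) \<and>
     (\<forall>x\<in>carrier H. vinner H x x = 0 \<longrightarrow> x = vzero H)"

definition inner_nspace :: "('v, 'r) ispace_scheme \<Rightarrow> 'v nspace" where
  "inner_nspace H =
     \<lparr>carrier = carrier H, vzero = vzero H, vadd = vadd H, vscale = vscale H,
      vnorm = (\<lambda>x. sqrt (vinner H x x))\<rparr>"

definition vdist :: "('v, 'r) nspace_scheme \<Rightarrow> 'v \<Rightarrow> 'v \<Rightarrow> real" where
  "vdist V x y = vnorm V (vadd V x (vscale V (-1) y))"

definition complete_nspace :: "('v, 'r) nspace_scheme \<Rightarrow> bool" where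
  "complete_nspace V \<longleftrightarrow>
     (\<forall>s :: nat \<Rightarrow> 'v. (\<forall>n. s n \<in> carrier V) \<and>
        (\<forall>e>0. \<exists>N. \<forall>m\<ge>N. \<forall>n\<ge>N. vdist V (s m) (s n) < e) \<longrightarrow>
        (\<exists>l\<in>carrier V. (\<lambda>n. vdist V (s n) l) \<longlonglongrightarrow> 0))"

definition hilbert_space :: "('v, 'r) ispace_scheme \<Rightarrow> bool" where
  "hilbert_space H \<longleftrightarrow> real_ispace H \<and> complete_nspace (inner_nspace H)"

lemma hilbert_space_UNIV:
  "hilbert_space \<lparr>carrier = (UNIV :: 'h::{real_inner, complete_space} set), vzero = 0,
     vadd = (+), vscale = scaleR, vinner = inner\<rparr>"
proof -
  let ?V = "inner_nspace \<lparr>carrier = (UNIV :: 'h set), vzero = 0,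
     vadd = (+), vscale = scaleR, vinner = inner\<rparr>"
  have d: "vdist ?V x y = dist x y" for x y :: 'h
    by (simp add: vdist_def inner_nspace_def dist_norm norm_eq_sqrt_inner)
  have "complete_nspace ?V"
    unfolding complete_nspace_def d
  proof (intro allI impI)
    fix s :: "nat \<Rightarrow> 'h"
    assume "(\<forall>n. s n \<in> carrier ?V) \<and> (\<forall>e>0. \<exists>N. \<forall>m\<ge>N. \<forall>n\<ge>N. dist (s m) (s n) < e)"
    then have "Cauchy s" by (simp add: Cauchy_def)
    then obtain l where "s \<longlonglongrightarrow> l" using convergent_def Cauchy_convergent by blast
    then show "\<exists>l\<in>carrier ?V. (\<lambda>n. dist (s n) l) \<longlonglongrightarrow> 0"
      using tendsto_dist_iff[of s l sequentially] by (auto simp: inner_nspace_def)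
  qed
  moreover have "\<exists>y. x + y = 0" for x :: 'h
    by (rule exI[of _ "- x"]) simp
  ultimately show ?thesis
    by (auto simp: hilbert_space_def real_ispace_def real_vspace_def algebra_simps
        inner_commute)
qed


text \<open>
  HOL cannot quantify existentially over the type of the elements of the Hilbert space. Since a
  Hilbert space isomorphic to \<open>'a\<close> has the cardinality of \<open>'a\<close>, a carrier inside \<open>'a\<close>, with
  arbitrary operations, is no restriction: see \<open>isomorphic_to_hilbertI\<close>.
\<close>

definition isomorphic_to_hilbert :: "'a::real_normed_vector itself \<Rightarrow> bool" where
  "isomorphic_to_hilbert _ \<longleftrightarrow>
     (\<exists>(H :: 'a ispace) f.
        hilbert_space H \<and> isomorphism (subspace_nspace (UNIV :: 'a set)) (inner_nspace H) f)"

lemma isomorphic_to_hilbertI: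
  fixes H :: "('h, 'r) ispace_scheme" and f :: "'a::real_normed_vector \<Rightarrow> 'h"
  assumes H: "hilbert_space H"
    and f: "isomorphism (subspace_nspace (UNIV :: 'a set)) (inner_nspace H) f"
  shows "isomorphic_to_hilbert TYPE('a)"
proof -
  define G :: "'a ispace" where
    "G = \<lparr>carrier = UNIV, vzero = 0, vadd = (+), vscale = scaleR,
          vinner = (\<lambda>x y. vinner H (f x) (f y))\<rparr>"
  have fin: "f x \<in> carrier H"
    and add: "f (x + y) = vadd H (f x) (f y)"
    and scale: "f (r *\<^sub>R x) = vscale H r (f x)" for x y r
    using f by (auto simp: isomorphism_def bounded_linear_map_def subspace_nspace_def
        inner_nspace_def)
  have bij: "bij_betw f UNIV (carrier H)"
    using f by (simp add: isomorphism_def subspace_nspace_def inner_nspace_def)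
  have inj: "f x = f y \<longleftrightarrow> x = y" for x y
    using bij by (auto simp: bij_betw_def inj_on_def)
  have Hi: "real_ispace H" and Hv: "real_vspace H"
    using H by (auto simp: hilbert_space_def real_ispace_def)
  have zero: "f 0 = vzero H"
  proof -
    have neg: "\<forall>x\<in>carrier H. \<exists>y\<in>carrier H. vadd H x y = vzero H"
      and assoc: "\<forall>x\<in>carrier H. \<forall>y\<in>carrier H. \<forall>z\<in>carrier H.
        vadd H (vadd H x y) z = vadd H x (vadd H y z)"
      and comm: "\<forall>x\<in>carrier H. \<forall>y\<in>carrier H. vadd H x y = vadd H y x"
      and zero: "vzero H \<in> carrier H" "\<forall>x\<in>carrier H. vadd H (vzero H) x = x"
      using Hv unfolding real_vspace_def by - (elim conjE, assumption)+
    obtain y where y: "y \<in> carrier H" "vadd H (f 0) y = vzero H"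
      using neg fin[of 0] by blast
    have "vadd H (f 0) (f 0) = f 0" using add[of 0 0] by simp
    then have "vzero H = vadd H (f 0) (vzero H)" using assoc fin[of 0] y by metis
    moreover have "vadd H (f 0) (vzero H) = f 0" using comm zero fin[of 0] by metis
    ultimately show ?thesis by simp
  qed
  have ex: "\<exists>y. x + y = 0" for x :: 'a by (rule exI[of _ "- x"]) simp
  have "real_vspace G"
    by (auto simp: real_vspace_def G_def algebra_simps ex)
  moreover have "vinner H (f x) (f x) = 0 \<Longrightarrow> x = 0" for x
    using Hi fin[of x] zero inj unfolding real_ispace_def by metis
  ultimately have "real_ispace G"
    using Hi fin unfolding real_ispace_def by (simp add: G_def add scale)
  moreover have "complete_nspace (inner_nspace G)"
  proof -
    have d: "vdist (inner_nspace G) x y = vdist (inner_nspace H) (f x) (f y)" for x y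
    proof -
      have "f (x - y) = vadd H (f x) (vscale H (- 1) (f y))"
        using add[of x "(-1) *\<^sub>R y"] scale[of "-1" y] by simp
      then show ?thesis by (simp add: vdist_def inner_nspace_def G_def)
    qed
    show ?thesis
      unfolding complete_nspace_def
    proof (intro allI impI)
      fix s :: "nat \<Rightarrow> 'a"
      assume s: "(\<forall>n. s n \<in> carrier (inner_nspace G)) \<and>
        (\<forall>e>0. \<exists>N. \<forall>m\<ge>N. \<forall>n\<ge>N. vdist (inner_nspace G) (s m) (s n) < e)"
      have "\<exists>l\<in>carrier (inner_nspace H). (\<lambda>n. vdist (inner_nspace H) (f (s n)) l) \<longlonglongrightarrow> 0"
        using H s fin unfolding hilbert_space_def complete_nspace_def d
        by (auto simp: inner_nspace_def elim!: allE[of _ "\<lambda>n. f (s n)"])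
      then obtain l where l: "l \<in> carrier H" "(\<lambda>n. vdist (inner_nspace H) (f (s n)) l) \<longlonglongrightarrow> 0"
        by (auto simp: inner_nspace_def)
      obtain x where "l = f x" using l(1) bij by (auto simp: bij_betw_def)
      then show "\<exists>l\<in>carrier (inner_nspace G). (\<lambda>n. vdist (inner_nspace G) (s n) l) \<longlonglongrightarrow> 0"
        using l(2) unfolding d by (auto simp: inner_nspace_def G_def)
    qed
  qed
  ultimately have "hilbert_space G" by (simp add: hilbert_space_def)
  moreover have "isomorphism (subspace_nspace UNIV) (inner_nspace G) (\<lambda>x. x)"
  proof -
    obtain K where K: "\<And>x. sqrt (vinner H (f x) (f x)) \<le> K * norm x"
      using f by (auto simp: isomorphism_def bounded_linear_map_def subspace_nspace_def
          inner_nspace_def)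
    have "\<exists>L. \<forall>y\<in>carrier H. norm (inv f y) \<le> L * sqrt (vinner H y y)"
      using f by (simp add: isomorphism_def bounded_linear_map_def subspace_nspace_def
          inner_nspace_def)
    then obtain L where L: "\<And>y. y \<in> carrier H \<Longrightarrow> norm (inv f y) \<le> L * sqrt (vinner H y y)"
      by blast
    have "norm x \<le> L * sqrt (vinner H (f x) (f x))" for x
      using L[OF fin[of x]] inj by (metis bij bij_betw_def inv_f_f)
    moreover have "inv (\<lambda>x::'a. x) = (\<lambda>x. x)"
      using inv_id by (simp add: id_def)
    ultimately show ?thesis
      using K by (auto simp: isomorphism_def bounded_linear_map_def subspace_nspace_def
          inner_nspace_def G_def bij_betw_def)
  qed
  ultimately show ?thesis unfolding isomorphic_to_hilbert_def by blast
qed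

end

theory Submission
  imports Defs
begin

text \<open>
  Put \<open>b x y = T x y\<close> and \<open>q x = b x x\<close>. The hypothesis on lines says that \<open>q\<close> vanishes only at
  \<open>0\<close>, so by connectedness \<open>q\<close> has constant sign; replacing \<open>T\<close> by \<open>- T\<close>, let it be positive. The
  symmetric part of \<open>b\<close> is then a continuous inner product on the space, and it makes the space
  an isomorphic copy of a Hilbert space as soon as \<open>q\<close> is coercive, that is,
  \<open>(norm x)\<^sup>2 \<le> C * q x\<close>.

  On a closed subspace \<open>M\<close> on which \<open>b\<close> is symmetric, coercivity is a consequence of the
  hypothesis for \<open>M\<close>: a functional \<open>\<lambda>z. b z y\<close> agrees on \<open>M\<close> with some \<open>b m\<close>, where \<open>m \<in> M\<close> and
  \<open>norm m\<close> is at most a multiple of \<open>norm y\<close>. Cauchy--Schwarz bounds \<open>b x y = b m x\<close> by a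
  multiple of \<open>norm y * sqrt (q x)\<close>, for every \<open>y\<close> in the whole space, and as \<open>T\<close> is bounded
  below this bounds \<open>norm x\<close> by a multiple of \<open>sqrt (q x)\<close>
  (\<open>coercive_on_symmetric_subspace\<close>).

  It remains to reduce the general case to that one. Suppose that \<open>q\<close> is not coercive. Coercivity
  would pass from a closed subspace of finite codimension to the whole space
  (\<open>coercive_on_finite_codim\<close>), so \<open>q\<close> is not coercive on the set of vectors that commute with a
  given finite set, where \<open>x\<close> and \<open>y\<close> commute if \<open>b x y = b y x\<close>. Hence one can choose
  inductively commuting vectors \<open>x n\<close> with \<open>(norm (x n))\<^sup>2 > n * q (x n)\<close>. They lie in a closed
  subspace on which \<open>b\<close> is symmetric, namely their double commutant, and there \<open>q\<close> is coercive
  after all: a contradiction.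
\<close>

section \<open>Positive bounded bilinear forms\<close>

definition coercive_on :: "'a::real_normed_vector set \<Rightarrow> ('a \<Rightarrow> 'a \<Rightarrow> real) \<Rightarrow> bool" where
  "coercive_on M b \<longleftrightarrow> (\<exists>C. \<forall>x\<in>M. (norm x)\<^sup>2 \<le> C * b x x)"

locale positive_form = bounded_bilinear b
  for b :: "'a::banach \<Rightarrow> 'a \<Rightarrow> real" +
  assumes positive: "x \<noteq> 0 \<Longrightarrow> 0 < b x x"
begin

lemma nonneg: "0 \<le> b x x"
  using positive[of x] by (cases "x = 0") (auto simp: zero_left)

lemma coercive_onE:
  assumes "coercive_on M b"
  obtains C where "0 \<le> C" "\<And>x. x \<in> M \<Longrightarrow> (norm x)\<^sup>2 \<le> C * b x x"
proof -
  obtain C where C: "\<And>x. x \<in> M \<Longrightarrow> (norm x)\<^sup>2 \<le> C * b x x"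
    using assms by (auto simp: coercive_on_def)
  show ?thesis
  proof
    fix x assume "x \<in> M"
    have "C * b x x \<le> \<bar>C\<bar> * b x x" by (rule mult_right_mono) (auto simp: nonneg)
    then show "(norm x)\<^sup>2 \<le> \<bar>C\<bar> * b x x" using C[OF \<open>x \<in> M\<close>] by simp
  qed simp
qed

text \<open>The parallelogram law, with one of its terms dropped.\<close>

lemma form_diff_le: "b (x - y) (x - y) \<le> 2 * b x x + 2 * b y y"
  using nonneg[of "x + y"] by (simp add: add_left add_right diff_left diff_right)

lemma form_cauchy_schwarz:
  assumes "b x y = b y x"
  shows "(b x y)\<^sup>2 \<le> b x x * b y y"
proof (cases "y = 0")
  case False
  then have y: "0 < b y y" by (rule positive)
  define t where "t = b x y / b y y"
  have "0 \<le> b (x - t *\<^sub>R y) (x - t *\<^sub>R y)" by (rule nonneg)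
  also have "\<dots> = b x x - 2 * t * b x y + t * t * b y y"
    by (simp add: diff_left diff_right scaleR_left scaleR_right assms algebra_simps)
  also have "\<dots> = b x x - (b x y)\<^sup>2 / b y y"
    using y by (simp add: t_def field_simps power2_eq_square)
  finally show ?thesis using y by (simp add: field_simps)
qed (simp add: zero_right)

text \<open>
  Completeness enters here: a vector outside a closed subspace on which \<open>b\<close> is coercive has
  positive \<open>b\<close>-distance from it, because a minimizing sequence for the distance \<open>0\<close> would be
  Cauchy for \<open>b\<close>, hence Cauchy in norm, and its limit would be the vector itself.
\<close>

lemma form_dist_pos:
  assumes H: "subspace H" "closed H" and co: "coercive_on H b" and e: "e \<notin> H"
  shows "\<exists>d>0. \<forall>h\<in>H. d \<le> b (e - h) (e - h)"
proof (rule ccontr)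
  assume "\<not> ?thesis"
  then have "\<forall>d>0. \<exists>h\<in>H. b (e - h) (e - h) < d" by (simp add: not_le)
  then have "\<forall>n. \<exists>h\<in>H. b (e - h) (e - h) < 1 / real (Suc n)" by simp
  then obtain h where hH: "\<And>n. h n \<in> H"
    and h: "\<And>n. b (e - h n) (e - h n) < 1 / real (Suc n)"
    by metis
  obtain C where C: "0 \<le> C" "\<And>x. x \<in> H \<Longrightarrow> (norm x)\<^sup>2 \<le> C * b x x"
    using co by (rule coercive_onE) blast
  have close: "(norm (h m - h n))\<^sup>2 \<le> C * (4 / real (Suc N))" if "N \<le> m" "N \<le> n" for m n N
  proof -
    have "b (h m - h n) (h m - h n) = b ((e - h n) - (e - h m)) ((e - h n) - (e - h m))"
      by simp
    also have "\<dots> \<le> 2 * b (e - h n) (e - h n) + 2 * b (e - h m) (e - h m)"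
      by (rule form_diff_le)
    also have "\<dots> \<le> 2 * (1 / real (Suc N)) + 2 * (1 / real (Suc N))"
    proof -
      have "1 / real (Suc k) \<le> 1 / real (Suc N)" if "N \<le> k" for k
        using that by (simp add: frac_le)
      from this[OF that(1)] this[OF that(2)] h[of m] h[of n] show ?thesis by linarith
    qed
    finally have "b (h m - h n) (h m - h n) \<le> 4 / real (Suc N)" by simp
    then show ?thesis
      using C(2)[OF subspace_diff[OF H(1) hH hH]] mult_left_mono[OF _ C(1)] order_trans by blast
  qed
  have "Cauchy h"
    unfolding Cauchy_def
  proof (intro allI impI)
    fix r :: real assume r: "0 < r"
    have "(\<lambda>N. C * (4 / real (Suc N))) \<longlonglongrightarrow> C * 0"
      by (intro tendsto_mult tendsto_const LIMSEQ_Suc[OF lim_const_over_n])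
    then have "\<forall>\<^sub>F N in sequentially. C * (4 / real (Suc N)) < r\<^sup>2"
      using r by (intro order_tendstoD) auto
    then obtain N where N: "C * (4 / real (Suc N)) < r\<^sup>2"
      by (auto simp: eventually_sequentially)
    have "dist (h m) (h n) < r" if "N \<le> m" "N \<le> n" for m n
      using close[OF that] N r power_less_imp_less_base[of "norm (h m - h n)" 2 r]
      by (simp add: dist_norm)
    then show "\<exists>N. \<forall>m\<ge>N. \<forall>n\<ge>N. dist (h m) (h n) < r" by blast
  qed
  then obtain l where l: "h \<longlonglongrightarrow> l" unfolding Cauchy_convergent_iff convergent_def by blast
  have "l \<in> H" using closed_sequentially[OF H(2)] hH l by blast
  have "(\<lambda>n. b (e - h n) (e - h n)) \<longlonglongrightarrow> b (e - l) (e - l)"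
    by (intro tendsto l tendsto_intros)
  moreover have "(\<lambda>n. b (e - h n) (e - h n)) \<longlonglongrightarrow> 0"
    by (rule tendsto_sandwich[OF _ _ tendsto_const LIMSEQ_Suc[OF lim_const_over_n[of 1]]])
       (use h in \<open>auto simp: nonneg less_imp_le\<close>)
  ultimately have "b (e - l) (e - l) = 0" by (rule LIMSEQ_unique)
  then have "e = l" using positive[of "e - l"] by auto
  with \<open>l \<in> H\<close> e show False by simp
qed

text \<open>
  If \<open>\<phi> e = 1\<close>, the \<open>b\<close>-distance from \<open>e\<close> to the kernel bounds \<open>(\<phi> x)\<^sup>2\<close> by a multiple of
  \<open>b x x\<close>. This controls the component \<open>\<phi> x *\<^sub>R e\<close> of \<open>x\<close>, and then coercivity on the kernel
  controls the rest.
\<close>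

lemma coercive_on_hyperplane:
  assumes N: "subspace N" "closed N" and \<phi>: "bounded_linear \<phi>"
    and co: "coercive_on {x \<in> N. \<phi> x = (0::real)} b"
  shows "coercive_on N b"
proof (cases "\<forall>x\<in>N. \<phi> x = 0")
  case True
  then have "{x \<in> N. \<phi> x = 0} = N" by auto
  with co show ?thesis by simp
next
  case False
  interpret \<phi>: bounded_linear \<phi> by (rule \<phi>)
  obtain e0 where e0: "e0 \<in> N" "\<phi> e0 \<noteq> 0" using False by blast
  define e where "e = (1 / \<phi> e0) *\<^sub>R e0"
  have e: "e \<in> N" "\<phi> e = 1"
    using e0 N by (auto simp: e_def subspace_scale \<phi>.scaleR)
  define H where "H = {x \<in> N. \<phi> x = 0}"
  have H: "subspace H"
    using N by (auto simp: H_def subspace_def \<phi>.add \<phi>.scaleR \<phi>.zero)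
  have "closed {x. \<phi> x = 0}"
    by (intro closed_Collect_eq continuous_intros \<phi>.continuous_on)
  then have clH: "closed H"
    using closed_Int[OF N(2)] by (simp add: H_def Collect_conj_eq)
  obtain C where C: "0 \<le> C" "\<And>x. x \<in> H \<Longrightarrow> (norm x)\<^sup>2 \<le> C * b x x"
    using co unfolding H_def by (rule coercive_onE) blast
  obtain d where d: "0 < d" "\<And>h. h \<in> H \<Longrightarrow> d \<le> b (e - h) (e - h)"
    using form_dist_pos[OF H clH, of e] co e by (auto simp: H_def)
  have "(norm x)\<^sup>2 \<le> (4 * C + (4 * C * b e e + 2 * (norm e)\<^sup>2) / d) * b x x" if x: "x \<in> N" for x
  proof -
    define t where "t = \<phi> x"
    define h where "h = x - t *\<^sub>R e"
    have h: "h \<in> H"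
      using x e N by (auto simp: H_def h_def t_def \<phi>.diff \<phi>.scaleR subspace_diff subspace_scale)
    have t: "t\<^sup>2 \<le> b x x / d"
    proof (cases "t = 0")
      case False
      have "x = t *\<^sub>R (e - (- (1 / t)) *\<^sub>R h)" using False by (simp add: h_def algebra_simps)
      then have "b x x = t\<^sup>2 * b (e - (- (1 / t)) *\<^sub>R h) (e - (- (1 / t)) *\<^sub>R h)"
        by (metis scaleR_left scaleR_right power2_eq_square mult.assoc real_scaleR_def)
      moreover have "d \<le> b (e - (- (1 / t)) *\<^sub>R h) (e - (- (1 / t)) *\<^sub>R h)"
        using d(2) subspace_scale[OF H h] by blast
      ultimately have "t\<^sup>2 * d \<le> b x x" by (simp add: mult_left_mono)
      then show ?thesis using d(1) by (simp add: field_simps)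
    qed (use d nonneg in simp)
    have "b h h \<le> 2 * b x x + 2 * b (t *\<^sub>R e) (t *\<^sub>R e)"
      unfolding h_def by (rule form_diff_le)
    also have "\<dots> = 2 * b x x + 2 * b e e * t\<^sup>2"
      by (simp add: scaleR_left scaleR_right power2_eq_square)
    finally have bh: "b h h \<le> 2 * b x x + 2 * b e e * t\<^sup>2" .
    have "norm x \<le> norm h + norm (t *\<^sub>R e)"
      using norm_triangle_ineq[of h "t *\<^sub>R e"] by (simp add: h_def)
    then have "(norm x)\<^sup>2 \<le> (norm h + norm (t *\<^sub>R e))\<^sup>2" by (rule power_mono) simp
    also have "\<dots> \<le> 2 * (norm h)\<^sup>2 + 2 * (norm (t *\<^sub>R e))\<^sup>2"
      using sum_squares_bound[of "norm h" "norm (t *\<^sub>R e)"] unfolding power2_sum by linarith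
    also have "\<dots> \<le> 2 * (C * (2 * b x x + 2 * b e e * t\<^sup>2)) + 2 * (norm e)\<^sup>2 * t\<^sup>2"
      using C(2)[OF h] mult_left_mono[OF bh C(1)] by (simp add: power_mult_distrib mult.commute)
    also have "\<dots> = 4 * C * b x x + (4 * C * b e e + 2 * (norm e)\<^sup>2) * t\<^sup>2"
      by (simp add: algebra_simps)
    also have "\<dots> \<le> 4 * C * b x x + (4 * C * b e e + 2 * (norm e)\<^sup>2) * (b x x / d)"
      using t C(1) nonneg[of e] by (intro add_left_mono mult_left_mono) auto
    finally show ?thesis by (simp add: algebra_simps add_divide_distrib)
  qed
  then show ?thesis unfolding coercive_on_def by blast
qed

lemma coercive_on_finite_codim:
  assumes "finite F" and \<phi>: "\<And>f. f \<in> F \<Longrightarrow> bounded_linear (\<phi> f)"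
    and "coercive_on {x. \<forall>f\<in>F. \<phi> f x = (0::real)} b"
  shows "coercive_on UNIV b"
  using assms
proof (induction F rule: finite_induct)
  case (insert f F)
  let ?N = "{x. \<forall>f\<in>F. \<phi> f x = 0}"
  have lin: "bounded_linear (\<phi> g)" if "g \<in> insert f F" for g using insert.prems(1) that .
  have "subspace ?N"
    using lin by (auto simp: subspace_def linear_simps)
  moreover have "closed ?N"
  proof -
    have "?N = (\<Inter>g\<in>F. {x. \<phi> g x = 0})" by auto
    also have "closed \<dots>"
      using lin by (intro closed_INT ballI closed_Collect_eq continuous_intros)
        (auto intro: linear_continuous_on)
    finally show ?thesis .
  qed
  moreover have "{x \<in> ?N. \<phi> f x = 0} = {x. \<forall>g\<in>insert f F. \<phi> g x = 0}" by auto
  ultimately have "coercive_on ?N b"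
    using coercive_on_hyperplane[of ?N "\<phi> f"] lin insert.prems(2) by simp
  then show ?case using insert.IH lin by simp
qed simp

section \<open>Subspaces on which the form is symmetric\<close>

definition commutant :: "'a set \<Rightarrow> 'a set" where
  "commutant S = {x. \<forall>y\<in>S. b x y - b y x = 0}"

lemma commutator_bounded_linear: "bounded_linear (\<lambda>x. b x y - b y x)"
  by (intro bounded_linear_sub bounded_linear_left bounded_linear_right)

lemma subspace_commutant: "subspace (commutant S)"
  by (auto simp: subspace_def commutant_def zero_left zero_right add_left add_right
      scaleR_left scaleR_right)

lemma closed_commutant: "closed (commutant S)"
proof -
  have "commutant S = (\<Inter>y\<in>S. {x. b x y - b y x = 0})" by (auto simp: commutant_def)
  also have "closed \<dots>"
    by (intro closed_INT ballI closed_Collect_eq linear_continuous_on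
        commutator_bounded_linear continuous_on_const)
  finally show ?thesis .
qed

text \<open>
  As in algebra, pairwise commuting vectors have a commutative double commutant. It serves as a
  closed subspace containing them on which \<open>b\<close> is symmetric.
\<close>

lemma double_commutant_symmetric:
  assumes "S \<subseteq> commutant S" "x \<in> commutant (commutant S)" "y \<in> commutant (commutant S)"
  shows "b x y = b y x"
proof -
  have "y \<in> commutant S" using assms(1,3) by (auto simp: commutant_def)
  then show ?thesis using assms(2) by (auto simp: commutant_def)
qed

lemma subset_double_commutant: "S \<subseteq> commutant (commutant S)"
  by (auto simp: commutant_def)

text \<open>
  Coercivity fails on the commutant of every finite set, so the next vector can always be chosen
  in the commutant of its predecessors.
\<close>

lemma noncoercive_commuting_sequence:
  assumes "\<not> coercive_on UNIV b"
  shows "\<exists>x :: nat \<Rightarrow> 'a. range x \<subseteq> commutant (range x) \<and>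
           (\<forall>n. real n * b (x n) (x n) < (norm (x n))\<^sup>2)"
proof -
  define P where "P = (\<lambda>(f :: nat \<Rightarrow> 'a) n r.
    (\<forall>i<n. b r (f i) - b (f i) r = 0) \<and> real n * b r r < (norm r)\<^sup>2)"
  have "\<exists>x. \<forall>n. P x n (x n)"
  proof (rule dependent_wellorder_choice)
    show "P f n r = P g n r" if "\<And>i. i < n \<Longrightarrow> f i = g i" for r f g n
      using that by (auto simp: P_def)
    fix n and f :: "nat \<Rightarrow> 'a"
    have "\<not> coercive_on {x. \<forall>i\<in>{..<n}. b x (f i) - b (f i) x = 0} b"
      using coercive_on_finite_codim[of "{..<n}" "\<lambda>i x. b x (f i) - b (f i) x"]
        commutator_bounded_linear assms by auto
    then obtain r where "\<forall>i\<in>{..<n}. b r (f i) - b (f i) r = 0" "\<not> (norm r)\<^sup>2 \<le> real n * b r r"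
      unfolding coercive_on_def by blast
    then show "\<exists>r. P f n r" by (intro exI[of _ r]) (simp add: P_def)
  qed
  then obtain x where x: "\<And>n. P x n (x n)" by blast
  have "b (x i) (x j) - b (x j) (x i) = 0" for i j
  proof (cases i j rule: linorder_cases)
    case less
    then show ?thesis using x[of j] by (auto simp: P_def)
  next
    case greater
    then show ?thesis using x[of i] by (auto simp: P_def)
  qed simp
  then show ?thesis using x by (intro exI[of _ x]) (auto simp: P_def commutant_def)
qed

text \<open>
  The norm of \<open>x\<close> is tested against vectors \<open>y\<close> of the whole space, which is what
  \<open>below\<close> provides; \<open>repr\<close> moves the test into \<open>M\<close>, where Cauchy--Schwarz applies. This avoids
  extending functionals from \<open>M\<close>.
\<close>

lemma coercive_on_symmetric_subspace:
  assumes below: "\<And>x D. 0 \<le> D \<Longrightarrow> (\<And>y. \<bar>b x y\<bar> \<le> D * norm y) \<Longrightarrow> norm x \<le> A * D"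
    and repr: "\<And>y. \<exists>m\<in>M. norm m \<le> C * norm y \<and> (\<forall>z\<in>M. b m z = b z y)"
    and sym: "\<And>x y. x \<in> M \<Longrightarrow> y \<in> M \<Longrightarrow> b x y = b y x"
  shows "coercive_on M b"
proof -
  obtain K where K: "0 < K" "\<And>x y. norm (b x y) \<le> norm x * norm y * K"
    using pos_bounded by blast
  have "(norm x)\<^sup>2 \<le> (A\<^sup>2 * C\<^sup>2 * K) * b x x" if x: "x \<in> M" for x
  proof -
    define D where "D = \<bar>C\<bar> * sqrt (K * b x x)"
    have D: "0 \<le> D" "D\<^sup>2 = C\<^sup>2 * K * b x x"
      using K nonneg[of x] by (auto simp: D_def power_mult_distrib)
    have "\<bar>b x y\<bar> \<le> D * norm y" for y
    proof -
      obtain m where m: "m \<in> M" "norm m \<le> C * norm y" "b m x = b x y"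
        using repr[of y] x by blast
      have mm: "(norm m)\<^sup>2 \<le> (C * norm y)\<^sup>2" using m(2) by (simp add: power_mono)
      have "(b x y)\<^sup>2 \<le> b m m * b x x"
        using form_cauchy_schwarz[OF sym[OF m(1) x]] m(3) by simp
      also have "\<dots> \<le> ((norm m)\<^sup>2 * K) * b x x"
        using K(2)[of m m] nonneg by (intro mult_right_mono) (auto simp: power2_eq_square)
      also have "\<dots> \<le> ((C * norm y)\<^sup>2 * K) * b x x"
        using mm K(1) nonneg by (intro mult_right_mono) auto
      also have "\<dots> = (D * norm y)\<^sup>2" by (simp add: D(2) power_mult_distrib)
      finally have "(b x y)\<^sup>2 \<le> (D * norm y)\<^sup>2" .
      then show ?thesis using D(1) abs_le_square_iff[of "b x y" "D * norm y"] by simp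
    qed
    then have "norm x \<le> A * D" by (rule below[OF D(1)])
    then have "(norm x)\<^sup>2 \<le> (A * D)\<^sup>2" by (rule power_mono) simp
    then show ?thesis by (simp add: D(2) power_mult_distrib mult.assoc)
  qed
  then show ?thesis unfolding coercive_on_def by blast
qed

lemma coercive_on_UNIV:
  assumes below: "\<And>x D. 0 \<le> D \<Longrightarrow> (\<And>y. \<bar>b x y\<bar> \<le> D * norm y) \<Longrightarrow> norm x \<le> A * D"
    and repr: "\<And>M. subspace M \<Longrightarrow> closed M \<Longrightarrow>
      \<exists>C. \<forall>y. \<exists>m\<in>M. norm m \<le> C * norm y \<and> (\<forall>z\<in>M. b m z = b z y)"
  shows "coercive_on UNIV b"
proof (rule ccontr)
  assume "\<not> coercive_on UNIV b"
  then obtain x :: "nat \<Rightarrow> 'a" where comm: "range x \<subseteq> commutant (range x)"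
    and x: "\<And>n. real n * b (x n) (x n) < (norm (x n))\<^sup>2"
    using noncoercive_commuting_sequence by blast
  define M where "M = commutant (commutant (range x))"
  obtain C where C: "\<And>y. \<exists>m\<in>M. norm m \<le> C * norm y \<and> (\<forall>z\<in>M. b m z = b z y)"
    using repr[of M] subspace_commutant closed_commutant unfolding M_def by blast
  have "coercive_on M b"
    using coercive_on_symmetric_subspace[OF below C] double_commutant_symmetric[OF comm]
    unfolding M_def by blast
  then obtain B where B: "\<And>x. x \<in> M \<Longrightarrow> (norm x)\<^sup>2 \<le> B * b x x" by (rule coercive_onE) blast
  obtain n :: nat where "B \<le> real n" using real_arch_simple by blast
  then have "B * b (x n) (x n) \<le> real n * b (x n) (x n)" by (intro mult_right_mono nonneg)
  moreover have "x n \<in> M" using subset_double_commutant unfolding M_def by blast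
  ultimately show False using B[of "x n"] x[of n] by linarith
qed

section \<open>The Hilbert space of a coercive form\<close>

lemma coercive_isomorphic_to_hilbert:
  assumes "coercive_on UNIV b"
  shows "isomorphic_to_hilbert TYPE('a)"
proof -
  obtain C where C: "0 \<le> C" "\<And>x. (norm x)\<^sup>2 \<le> C * b x x"
    using assms by (rule coercive_onE) blast
  obtain K where K: "0 < K" "\<And>x y. norm (b x y) \<le> norm x * norm y * K"
    using pos_bounded by blast
  define H :: "'a ispace" where
    "H = \<lparr>carrier = UNIV, vzero = 0, vadd = (+), vscale = scaleR,
          vinner = (\<lambda>x y. (b x y + b y x) / 2)\<rparr>"
  have ex: "\<exists>y. x + y = 0" for x :: 'a by (rule exI[of _ "- x"]) simp
  have "real_vspace H"
    by (auto simp: real_vspace_def H_def algebra_simps ex)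
  moreover have "b x x = 0 \<Longrightarrow> x = 0" for x using positive[of x] by auto
  ultimately have inner: "real_ispace H"
    unfolding real_ispace_def
    by (auto simp: H_def nonneg add_left add_right scaleR_left scaleR_right field_simps)
  have lower: "norm x \<le> sqrt C * sqrt (b x x)" for x
    using real_le_rsqrt[OF C(2)[of x]] by (simp add: real_sqrt_mult)
  have upper: "sqrt (b x x) \<le> sqrt K * norm x" for x
  proof -
    have "b x x \<le> K * (norm x)\<^sup>2" using K(2)[of x x] by (simp add: power2_eq_square mult.commute)
    then have "sqrt (b x x) \<le> sqrt (K * (norm x)\<^sup>2)" by simp
    then show ?thesis by (simp add: real_sqrt_mult)
  qed
  have d: "vdist (inner_nspace H) x y = sqrt (b (x - y) (x - y))" for x y
    by (simp add: vdist_def inner_nspace_def H_def)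
  have "complete_nspace (inner_nspace H)"
    unfolding complete_nspace_def d
  proof (intro allI impI, elim conjE)
    fix s :: "nat \<Rightarrow> 'a"
    assume s: "\<forall>e>0. \<exists>N. \<forall>m\<ge>N. \<forall>n\<ge>N. sqrt (b (s m - s n) (s m - s n)) < e"
    have "Cauchy s"
      unfolding Cauchy_def
    proof (intro allI impI)
      fix e :: real assume e: "0 < e"
      have C1: "0 < sqrt C + 1" using C(1) by (simp add: add_nonneg_pos)
      then obtain N where N: "\<And>m n. m \<ge> N \<Longrightarrow> n \<ge> N \<Longrightarrow>
          sqrt (b (s m - s n) (s m - s n)) < e / (sqrt C + 1)"
        using s e by (meson divide_pos_pos)
      have "dist (s m) (s n) < e" if "m \<ge> N" "n \<ge> N" for m n
      proof -
        have "dist (s m) (s n) \<le> (sqrt C + 1) * sqrt (b (s m - s n) (s m - s n))"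
          using lower[of "s m - s n"] nonneg[of "s m - s n"]
          by (simp add: dist_norm distrib_right add_increasing2)
        also have "\<dots> < e"
          using N[OF that] C1 by (simp add: pos_less_divide_eq mult.commute)
        finally show ?thesis .
      qed
      then show "\<exists>N. \<forall>m\<ge>N. \<forall>n\<ge>N. dist (s m) (s n) < e" by blast
    qed
    then obtain l where l: "s \<longlonglongrightarrow> l" unfolding Cauchy_convergent_iff convergent_def by blast
    have "(\<lambda>n. sqrt (b (s n - l) (s n - l))) \<longlonglongrightarrow> sqrt (b (l - l) (l - l))"
      by (intro tendsto_real_sqrt tendsto l tendsto_intros)
    then show "\<exists>l\<in>carrier (inner_nspace H). (\<lambda>n. sqrt (b (s n - l) (s n - l))) \<longlonglongrightarrow> 0"
      by (auto simp: inner_nspace_def H_def zero_left)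
  qed
  then have "hilbert_space H" using inner by (simp add: hilbert_space_def)
  moreover have "isomorphism (subspace_nspace UNIV) (inner_nspace H) (\<lambda>x. x)"
  proof -
    have "inv (\<lambda>x::'a. x) = (\<lambda>x. x)" using inv_id by (simp add: id_def)
    then show ?thesis
      using lower upper by (auto simp: isomorphism_def bounded_linear_map_def subspace_nspace_def
          inner_nspace_def H_def bij_betw_def)
  qed
  ultimately show ?thesis by (rule isomorphic_to_hilbertI)
qed

end

section \<open>Anisotropic forms\<close>

text \<open>
  On a segment from a vector with \<open>b x x < 0\<close> to one with \<open>b y y > 0\<close> the quadratic form vanishes
  somewhere, hence the segment meets \<open>0\<close>. But then \<open>y\<close> is a multiple of \<open>x\<close> and \<open>b y y \<le> 0\<close>.
\<close>

lemma anisotropic_imp_definite: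
  fixes b :: "'a::real_normed_vector \<Rightarrow> 'a \<Rightarrow> real"
  assumes "bounded_bilinear b" and nz: "\<And>x. x \<noteq> 0 \<Longrightarrow> b x x \<noteq> 0"
  shows "(\<forall>x. x \<noteq> 0 \<longrightarrow> 0 < b x x) \<or> (\<forall>x. x \<noteq> 0 \<longrightarrow> b x x < 0)"
proof (rule ccontr)
  interpret bounded_bilinear b by fact
  assume "\<not> ?thesis"
  then obtain x y where "x \<noteq> 0" "\<not> 0 < b x x" "y \<noteq> 0" "\<not> b y y < 0" by blast
  then have x: "b x x < 0" and y: "0 < b y y" using nz[of x] nz[of y] by auto
  define g where "g t = x + t *\<^sub>R (y - x)" for t
  have "\<exists>t\<ge>0. t \<le> 1 \<and> b (g t) (g t) = 0"
    by (rule IVT') (use x y in \<open>auto simp: g_def intro!: continuous_on continuous_intros\<close>)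
  then obtain t where t: "b (g t) (g t) = 0" by blast
  then have "g t = 0" using nz by blast
  then have eq: "t *\<^sub>R y = (t - 1) *\<^sub>R x" by (simp add: g_def algebra_simps eq_neg_iff_add_eq_0)
  have "t\<^sup>2 * b y y = b (t *\<^sub>R y) (t *\<^sub>R y)"
    by (simp add: scaleR_left scaleR_right power2_eq_square)
  also have "\<dots> = (t - 1)\<^sup>2 * b x x"
    unfolding eq by (simp add: scaleR_left scaleR_right power2_eq_square)
  finally have eq2: "t\<^sup>2 * b y y = (t - 1)\<^sup>2 * b x x" .
  have "0 \<le> t\<^sup>2 * b y y" "(t - 1)\<^sup>2 * b x x \<le> 0"
    using x y by (auto simp: mult_nonneg_nonpos)
  then have "t\<^sup>2 * b y y = 0" "(t - 1)\<^sup>2 * b x x = 0" using eq2 by linarith+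
  then show False using x y by simp
qed

lemma closed_span_singleton:
  fixes x :: "'a::banach"
  assumes "x \<noteq> 0"
  shows "closed (span {x})"
proof -
  have "complete ((\<lambda>r. r *\<^sub>R x) ` UNIV)"
    by (rule complete_isometric_image[of "norm x"])
      (use assms in \<open>auto simp: bounded_linear_scaleR_left complete_UNIV\<close>)
  then show ?thesis by (simp add: span_singleton complete_imp_closed)
qed

lemma form_isomorphic_to_hilbert:
  fixes b :: "'a::banach \<Rightarrow> 'a \<Rightarrow> real"
  assumes bil: "bounded_bilinear b"
    and below: "\<And>x D. 0 \<le> D \<Longrightarrow> (\<And>y. \<bar>b x y\<bar> \<le> D * norm y) \<Longrightarrow> norm x \<le> A * D"
    and repr: "\<And>M. subspace M \<Longrightarrow> closed M \<Longrightarrow>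
      \<exists>C. \<forall>y. \<exists>m\<in>M. norm m \<le> C * norm y \<and> (\<forall>z\<in>M. b m z = b z y)"
  shows "isomorphic_to_hilbert TYPE('a)"
proof -
  interpret bounded_bilinear b by (rule bil)
  have nz: "b x x \<noteq> 0" if "x \<noteq> 0" for x
  proof
    assume 0: "b x x = 0"
    \<comment> \<open>All \<open>b m\<close> with \<open>m\<close> on the line of \<open>x\<close> vanish at \<open>x\<close>, and \<open>repr\<close> lets one of them
      agree with \<open>\<lambda>z. b z y\<close> there.\<close>
    have "b x y = 0" for y
    proof -
      have "\<exists>C. \<forall>y. \<exists>m\<in>span {x}. norm m \<le> C * norm y \<and> (\<forall>z\<in>span {x}. b m z = b z y)"
        using that by (intro repr subspace_span closed_span_singleton)
      then obtain m where m: "m \<in> span {x}" "\<forall>z\<in>span {x}. b m z = b z y" by blast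
      obtain r where "m = r *\<^sub>R x" using m(1) by (auto simp: span_singleton)
      then have "b m x = 0" by (simp add: scaleR_left 0)
      then show ?thesis using m(2) by (simp add: span_base)
    qed
    then have "norm x \<le> A * 0" by (intro below) auto
    with that show False by simp
  qed
  from anisotropic_imp_definite[OF bil nz] show ?thesis
  proof
    assume "\<forall>x. x \<noteq> 0 \<longrightarrow> 0 < b x x"
    then interpret positive_form b by unfold_locales auto
    from coercive_isomorphic_to_hilbert[OF coercive_on_UNIV[OF below repr]] show ?thesis by blast
  next
    assume "\<forall>x. x \<noteq> 0 \<longrightarrow> b x x < 0"
    moreover have "bounded_bilinear (\<lambda>x y. - b x y)"
      using comp[OF bounded_linear_minus[OF bounded_linear_ident] bounded_linear_ident]
      by (simp add: minus_left)
    ultimately interpret neg: positive_form "\<lambda>x y. - b x y"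
      by (simp add: positive_form_def positive_form_axioms_def)
    have "coercive_on UNIV (\<lambda>x y. - b x y)"
      by (rule neg.coercive_on_UNIV[of A]) (use below repr in auto)
    then show ?thesis by (rule neg.coercive_isomorphic_to_hilbert)
  qed
qed

section \<open>Self-dual spaces\<close>

text \<open>
  The quotient norm of the coset of \<open>g\<close> is at most \<open>norm g\<close>, so the inverse isomorphism
  represents \<open>g\<close> on \<open>M\<close> by a vector whose norm is controlled by that of \<open>g\<close>.
\<close>

lemma isomorphism_quotient_representation:
  fixes T :: "'a::real_normed_vector \<Rightarrow> ('a \<Rightarrow>\<^sub>L real)"
  assumes iso: "isomorphism (subspace_nspace M) (quotient_nspace (annihilator M))
             (quotient_proj (annihilator M) \<circ> T)"
  shows "\<exists>C. \<forall>g. \<exists>m\<in>M. norm m \<le> C * norm g \<and> (\<forall>z\<in>M. T m z = blinfun_apply g z)"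
proof -
  let ?N = "annihilator M" and ?f = "quotient_proj (annihilator M) \<circ> T"
  have bij: "bij_betw ?f M (range (quotient_proj ?N))"
    using iso by (simp add: isomorphism_def quotient_nspace_def)
  obtain C where C: "\<And>g. norm (inv_into M ?f (quotient_proj ?N g)) \<le>
      C * Inf (norm ` quotient_proj ?N g)"
    using iso by (auto simp: isomorphism_def bounded_linear_map_def quotient_nspace_def
        subspace_nspace_def)
  have "\<exists>m\<in>M. norm m \<le> \<bar>C\<bar> * norm g \<and> (\<forall>z\<in>M. T m z = blinfun_apply g z)" for g
  proof (intro bexI conjI ballI)
    let ?m = "inv_into M ?f (quotient_proj ?N g)"
    have img: "quotient_proj ?N g \<in> ?f ` M" using bij by (simp add: bij_betw_def)
    then show "?m \<in> M" by (rule inv_into_into)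
    have "?f ?m = quotient_proj ?N g" using img by (rule f_inv_into_f)
    then have "T ?m - g \<in> ?N" by (simp add: quotient_proj_eq_iff subspace_annihilator)
    then show "T ?m z = blinfun_apply g z" if "z \<in> M" for z
      using that by (simp add: annihilator_def minus_blinfun.rep_eq)
    have "g \<in> quotient_proj ?N g"
      using subspace_0[OF subspace_annihilator] by (force simp: quotient_proj_def)
    then have inf: "Inf (norm ` quotient_proj ?N g) \<le> norm g"
      by (intro cInf_lower imageI) (auto intro: bdd_belowI[of _ 0])
    have inf0: "0 \<le> Inf (norm ` quotient_proj ?N g)"
      by (rule cInf_greatest) (use \<open>g \<in> quotient_proj ?N g\<close> in auto)
    have "norm ?m \<le> C * Inf (norm ` quotient_proj ?N g)" by (rule C)
    also have "\<dots> \<le> \<bar>C\<bar> * norm g" using inf inf0 by (intro mult_mono) auto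
    finally show "norm ?m \<le> \<bar>C\<bar> * norm g" .
  qed
  then show ?thesis by blast
qed

theorem proposition3p1:
  fixes T :: "'a::banach \<Rightarrow> ('a \<Rightarrow>\<^sub>L real)"
  assumes "bounded_linear T" and "bij T" and "bounded_linear (inv T)"
    and "\<And>M. subspace M \<Longrightarrow> closed M \<Longrightarrow>
           isomorphism (subspace_nspace M) (quotient_nspace (annihilator M))
             (quotient_proj (annihilator M) \<circ> T)"
  shows "isomorphic_to_hilbert TYPE('a)"
proof -
  have bil: "bounded_bilinear (\<lambda>x y. T x y)"
    using bounded_bilinear.comp1[OF bounded_bilinear_blinfun_apply assms(1)] .
  interpret bounded_bilinear "\<lambda>x y. T x y" by (rule bil)
  obtain A where A: "0 \<le> A" "\<And>g. norm (inv T g) \<le> norm g * A"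
    using bounded_linear.nonneg_bounded[OF assms(3)] by blast
  obtain K where K: "0 \<le> K" "\<And>x y. norm (T x y) \<le> norm x * norm y * K"
    using nonneg_bounded by blast
  show ?thesis
  proof (rule form_isomorphic_to_hilbert[OF bil, of A])
    fix x :: 'a and D :: real assume D: "0 \<le> D" "\<And>y. \<bar>T x y\<bar> \<le> D * norm y"
    have "norm (T x) \<le> D" using D by (intro norm_blinfun_bound) auto
    then have "norm (T x) * A \<le> D * A" using A(1) by (rule mult_right_mono)
    moreover have "inv T (T x) = x" using assms(2) by (simp add: bij_is_inj)
    ultimately show "norm x \<le> A * D" using A(2)[of "T x"] by (simp add: mult.commute)
  next
    fix M :: "'a set" assume "subspace M" "closed M"
    from isomorphism_quotient_representation[OF assms(4)[OF this]]
    obtain C where C: "\<And>g. \<exists>m\<in>M. norm m \<le> C * norm g \<and> (\<forall>z\<in>M. T m z = blinfun_apply g z)" by blast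
    have "\<exists>m\<in>M. norm m \<le> (\<bar>C\<bar> * K) * norm y \<and> (\<forall>z\<in>M. T m z = T z y)" for y
    proof -
      define g where "g = Blinfun (\<lambda>z. T z y)"
      have g: "blinfun_apply g z = T z y" for z
        unfolding g_def by (simp add: bounded_linear_Blinfun_apply bounded_linear_left)
      have "norm g \<le> K * norm y"
        using K by (intro norm_blinfun_bound) (auto simp: g mult_ac)
      moreover obtain m where m: "m \<in> M" "norm m \<le> C * norm g" "\<forall>z\<in>M. T m z = blinfun_apply g z"
        using C by blast
      have "C * norm g \<le> \<bar>C\<bar> * norm g" by (simp add: mult_right_mono)
      ultimately have "norm m \<le> \<bar>C\<bar> * (K * norm y)"
        using m(2) mult_left_mono[of "norm g" "K * norm y" "\<bar>C\<bar>"] by simp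
      then show ?thesis using m by (auto simp: g mult.assoc)
    qed
    then show "\<exists>C. \<forall>y. \<exists>m\<in>M. norm m \<le> C * norm y \<and> (\<forall>z\<in>M. T m z = T z y)" by blast
  qed
qed

end
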